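(* Let $h,i,j,k,l$ be non-negative integers. Then the following assertions are equivalent: (a) the integers $j+k-h$, $k+l-i$, $l+h-j$, $h+i-k$, $i+j-l$ are all non-negative; (b) the integral $I(h,i,j,k,l)$ is an irrational number.
   Context: For non-negative integers $h,i,j,k,l$, $I(h,i,j,k,l)=\int_0^1\!\int_0^1\frac{x^h(1-x)^iy^k(1-y)^j}{(1-xy)^{i+j-l+1}}\,dx\,dy$ (a convergent integral). *)

theory Defs
  imports "HOL-Analysis.Analysis"
begin

text \<open>
  The double integral is the Lebesgue integral over the closed unit square. The exponent of
  \<open>1 - x * y\<close> can be negative, so it is an integer, computed without truncation. At the corner
  \<open>(1, 1)\<close>, the only point of the square where \<open>1 - x * y = 0\<close>, the value of the integrand is
  irrelevant. The integrand is nonnegative and integrable for all parameters, as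
  \<open>(1 - x) ^ i * (1 - y) ^ j \<le> (1 - x * y) ^ (i + j)\<close> and \<open>1 / (1 - x * y)\<close> is integrable.
\<close>

definition I_integral :: "nat \<Rightarrow> nat \<Rightarrow> nat \<Rightarrow> nat \<Rightarrow> nat \<Rightarrow> real" where
  "I_integral h i j k l =
     (LINT (x, y) : {0..1} \<times> {0..1} | lborel.
        (x ^ h * (1 - x) ^ i * y ^ k * (1 - y) ^ j)
          / (1 - x * y) powi (int i + int j - int l + 1))"

end

theory Submission
  imports Defs
begin

text \<open>
  For \<open>n = i + j - l \<ge> 0\<close>, expanding \<open>1 / (1 - x y)^(n + 1)\<close> into its binomial series and integrating
  termwise gives
  \<open>I = (i! j! / n!) \<Sum>m (m + 1)\<dots>(m + n) / (\<Prod>s\<in>S. (m + s) \<Prod>t\<in>T. (m + t))\<close>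
  with \<open>S = {h + 1..h + i + 1}\<close> and \<open>T = {k + 1..k + j + 1}\<close>. As \<open>n \<le> i + j\<close>, the numerator splits into
  two factors such that each of the two quotients, over \<open>S\<close> and over \<open>T\<close>, is proper and has simple poles
  only. Multiplying their partial fractions, the products with distinct poles telescope to rational
  numbers, and those with a common pole \<open>p\<close> contribute a rational number plus \<open>\<pi>\<^sup>2 / 6\<close> times a
  coefficient. This coefficient vanishes for \<open>p \<le> n\<close> and has the sign \<open>(-1)^(n + h + k)\<close>, independent
  of \<open>p\<close>, for \<open>p > n\<close>. So \<open>I = A \<pi>\<^sup>2 + r\<close> with rational \<open>A\<close> and \<open>r\<close>, where \<open>A \<noteq> 0\<close> iff
  \<open>max h k n \<le> min (h + i) (k + j)\<close>, and this is condition (a). For \<open>n < 0\<close> the integrand is a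
  polynomial. It remains to use that \<open>\<pi>\<^sup>2\<close> is irrational.
\<close>

subsection \<open>Irrationality of \<open>\<pi>\<^sup>2\<close>\<close>

lemma pochhammer_ge_power:
  fixes x :: real
  assumes "0 \<le> x"
  shows "x ^ m \<le> pochhammer x m"
proof (induction m)
  case (Suc m)
  have "x ^ m * x \<le> pochhammer x m * (x + real m)"
    by (intro mult_mono Suc order_trans[OF zero_le_power Suc]) (use assms in auto)
  then show ?case by (simp add: pochhammer_Suc mult.commute)
qed simp

text \<open>
  Laczkovich's proof: if \<open>y = \<pi>\<^sup>2 / 4\<close> were rational, the three-term recurrence below would make
  suitable multiples \<open>c^n * laczkovich y n\<close> integers, but they are positive for large \<open>n\<close> and tend
  to \<open>0\<close>. The two initial values are \<open>cos \<pi>\<close> and \<open>2 sin \<pi> / \<pi>\<close>.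
\<close>

definition laczkovich_term :: "real \<Rightarrow> nat \<Rightarrow> nat \<Rightarrow> real" where
  "laczkovich_term y n m = (- y) ^ m / (fact m * pochhammer (1/2) (n + m))"

definition laczkovich :: "real \<Rightarrow> nat \<Rightarrow> real" where
  "laczkovich y n = (\<Sum>m. laczkovich_term y n m)"

lemma pochhammer_half_pos: "pochhammer (1/2 :: real) n > 0"
  by (simp add: pochhammer_pos)

text \<open>The factor \<open>pochhammer (1/2) n\<close> splits off from the denominator; what
  remains is at least \<open>(n + 1/2) ^ m\<close>, which leaves a term of an exponential
  series.\<close>

lemma laczkovich_term_bound:
  assumes "0 \<le> y"
  shows "\<bar>laczkovich_term y n m\<bar> * pochhammer (1/2) n \<le> (y / (real n + 1/2)) ^ m / fact m"
proof -
  define P where "P = pochhammer (1/2 :: real) n"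
  define Q where "Q = pochhammer (1/2 + real n) m"
  define z where "z = 1/2 + real n"
  have "z > 0" by (simp add: z_def)
  then have pos: "P > 0" "Q > 0" "z ^ m > 0"
    by (auto simp: P_def Q_def z_def pochhammer_pos)
  have "z ^ m \<le> Q" unfolding z_def Q_def by (rule pochhammer_ge_power) simp
  have PQ: "pochhammer (1/2 :: real) (n + m) = P * Q"
    unfolding P_def Q_def by (rule pochhammer_product')
  have "\<bar>laczkovich_term y n m\<bar> = y ^ m / (fact m * (P * Q))"
    unfolding laczkovich_term_def PQ using assms pos by (simp add: abs_mult power_abs)
  then have "\<bar>laczkovich_term y n m\<bar> * P = y ^ m / (fact m * Q)"
    using pos by simp
  also have "\<dots> \<le> y ^ m / (fact m * z ^ m)"
    using assms pos \<open>z ^ m \<le> Q\<close> by (intro divide_left_mono mult_left_mono) auto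
  also have "\<dots> = (y / z) ^ m / fact m"
    by (simp only: power_divide divide_divide_eq_left mult.commute)
  finally show ?thesis by (simp only: P_def z_def add.commute)
qed

lemma exp_sums_real: "(\<lambda>m. x ^ m / fact m) sums exp (x::real)"
  using exp_converges[of x] by (simp add: scaleR_conv_of_real divide_inverse mult.commute)

lemma laczkovich_term_summable:
  assumes "0 \<le> y"
  shows "summable (laczkovich_term y n)"
proof (rule summable_comparison_test')
  show "summable (\<lambda>m. (y / (real n + 1/2)) ^ m / fact m / pochhammer (1/2) n)"
    by (intro summable_divide sums_summable[OF exp_sums_real])
  show "norm (laczkovich_term y n m) \<le> (y / (real n + 1/2)) ^ m / fact m / pochhammer (1/2) n" if "m \<ge> 0" for m
    using laczkovich_term_bound[OF assms, of n m] pochhammer_half_pos[of n] by (simp add: field_simps)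
qed

text \<open>After normalisation the term for \<open>m = 0\<close> is \<open>1\<close>, and the other
  terms are dominated by the exponential series without its first term. The right-hand side tends to
  \<open>0\<close> as \<open>n\<close> grows, which later gives positivity.\<close>

lemma laczkovich_bound:
  assumes "0 \<le> y"
  shows "\<bar>laczkovich y n * pochhammer (1/2) n - 1\<bar> \<le> exp (y / (real n + 1/2)) - 1"
proof -
  let ?P = "pochhammer (1/2 :: real) n" and ?z = "y / (real n + 1/2)"
  have P: "?P > 0" by (rule pochhammer_half_pos)
  have "(\<lambda>m. laczkovich_term y n m * ?P) sums (laczkovich y n * ?P)"
    unfolding laczkovich_def by (intro sums_mult2 summable_sums laczkovich_term_summable assms)
  then have 1: "(\<lambda>m. laczkovich_term y n (Suc m) * ?P) sums (laczkovich y n * ?P - 1)"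
    using P by (subst sums_Suc_iff) (simp add: laczkovich_term_def)
  have 2: "(\<lambda>m. ?z ^ Suc m / fact (Suc m)) sums (exp ?z - 1)"
    using exp_sums_real[of ?z] by (subst sums_Suc_iff) simp
  show ?thesis
  proof (rule norm_suminf_le[of "\<lambda>m. laczkovich_term y n (Suc m) * ?P" "\<lambda>m. ?z ^ Suc m / fact (Suc m)",
        folded sums_unique[OF 1] sums_unique[OF 2], unfolded real_norm_def])
    show "\<bar>laczkovich_term y n (Suc m) * ?P\<bar> \<le> ?z ^ Suc m / fact (Suc m)" for m
      using laczkovich_term_bound[OF assms, of n "Suc m"] P by (simp add: abs_mult)
    show "summable (\<lambda>m. ?z ^ Suc m / fact (Suc m))" using 2 by (rule sums_summable)
  qed
qed

text \<open>The recurrence holds termwise after an index shift: the term of index \<open>m\<close>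
  on the right carries a factor \<open>m\<close>, so it vanishes at \<open>0\<close>, and at
  \<open>Suc m\<close> that factor cancels against the factorial.\<close>

lemma laczkovich_rec:
  assumes "0 \<le> y"
  shows "y * laczkovich y (n + 2) = (real n + 1/2) * laczkovich y (n + 1) - laczkovich y n"
proof -
  let ?f = "\<lambda>m. (real n + 1/2) * laczkovich_term y (n + 1) m - laczkovich_term y n m"
  have 1: "?f sums ((real n + 1/2) * laczkovich y (n + 1) - laczkovich y n)"
    unfolding laczkovich_def by (intro sums_diff sums_mult summable_sums laczkovich_term_summable assms)
  have f: "?f m = - real m * (- y) ^ m / (fact m * pochhammer (1/2) (n + m + 1))" for m
  proof -
    define Q where "Q = pochhammer (1/2 :: real) (n + m)"
    define d where "d = real n + 1/2 + real m"
    have pos: "Q > 0" "d > 0" by (auto simp: Q_def d_def pochhammer_half_pos)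
    have Q: "pochhammer (1/2 :: real) (n + m + 1) = Q * d"
      by (simp add: pochhammer_Suc Q_def d_def add_ac)
    \<comment> \<open>Over the common denominator the two numerators have the factors
      \<open>n + 1/2\<close> and \<open>d\<close>, which differ by \<open>- m\<close>.\<close>
    have "?f m = (real n + 1/2) * (- y) ^ m / (fact m * (Q * d)) - d * (- y) ^ m / (fact m * (Q * d))"
    proof -
      have "laczkovich_term y (n + 1) m = (- y) ^ m / (fact m * (Q * d))"
        unfolding laczkovich_term_def by (subst Q[symmetric]) (simp add: add_ac)
      moreover have "laczkovich_term y n m = d * (- y) ^ m / (fact m * (Q * d))"
        using pos by (simp add: laczkovich_term_def Q_def)
      ultimately show ?thesis by simp
    qed
    also have "\<dots> = - real m * (- y) ^ m / (fact m * (Q * d))"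
      unfolding diff_divide_distrib[symmetric] left_diff_distrib[symmetric] by (simp add: d_def)
    finally show ?thesis by (simp only: Q)
  qed
  have f': "?f (Suc m) = y * laczkovich_term y (n + 2) m" for m
  proof -
    have idx: "n + Suc m + 1 = n + 2 + m" by simp
    have "fact (Suc m) = real (Suc m) * fact m" by (rule fact_Suc)
    then have "real (Suc m) * y * (- y) ^ m / (fact (Suc m) * P) = y * (- y) ^ m / (fact m * P)" for P
      by (simp del: fact_Suc of_nat_Suc)
    then show ?thesis
      unfolding f unfolding laczkovich_term_def idx by (simp del: fact_Suc of_nat_Suc add: mult.assoc)
  qed
  have "(\<lambda>m. ?f (Suc m)) sums ((real n + 1/2) * laczkovich y (n + 1) - laczkovich y n)"
  proof -
    have "?f 0 = 0" unfolding f by simp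
    with 1 show ?thesis by (simp only: sums_Suc_iff[of ?f] add_0_right)
  qed
  moreover have "(\<lambda>m. ?f (Suc m)) sums (y * laczkovich y (n + 2))"
    unfolding f' laczkovich_def by (intro sums_mult summable_sums laczkovich_term_summable assms)
  ultimately show ?thesis by (rule sums_unique2[symmetric])
qed

lemma power2_power: "(x\<^sup>2) ^ m = (x ^ m)\<^sup>2" for x :: real
  by (simp add: power_mult[symmetric] mult.commute)

text \<open>The identity \<open>(2 m)! = 4^m m! pochhammer (1/2) m\<close> turns the terms into
  those of the cosine series.\<close>

lemma laczkovich_0: "laczkovich (x\<^sup>2 / 4) 0 = cos x"
proof -
  have "laczkovich_term (x\<^sup>2 / 4) 0 m = (- 1) ^ m / fact (2 * m) * x ^ (2 * m)" for m
  proof -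
    have "(fact (2 * m) :: real) = 4 ^ m * (fact m * pochhammer (1/2) m)"
      by (simp add: fact_double power_mult)
    then show ?thesis
      by (simp add: laczkovich_term_def power_minus[of "x\<^sup>2 / 4"] power_divide power_mult mult_ac power2_power)
  qed
  then show ?thesis
    using cos_paired[of x] by (simp add: laczkovich_def sums_iff)
qed

lemma laczkovich_1: "x * laczkovich (x\<^sup>2 / 4) 1 = 2 * sin x"
proof -
  have "x * laczkovich_term (x\<^sup>2 / 4) 1 m = 2 * ((- 1) ^ m / fact (2 * m + 1) * x ^ (2 * m + 1))" for m
  proof -
    have "(fact (2 * m) :: real) = 4 ^ m * (fact m * pochhammer (1/2) m)"
      by (simp add: fact_double power_mult)
    then have "(fact (2 * m + 1) :: real) = 2 * (4 ^ m * (fact m * pochhammer (1/2) (1 + m)))"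
      by (simp add: pochhammer_Suc field_simps)
    then show ?thesis
      by (simp add: laczkovich_term_def power_minus[of "x\<^sup>2 / 4"] power_divide power_mult mult_ac power2_power)
  qed
  moreover have "(\<lambda>m. x * laczkovich_term (x\<^sup>2 / 4) 1 m) sums (x * laczkovich (x\<^sup>2 / 4) 1)"
    unfolding laczkovich_def by (intro sums_mult summable_sums laczkovich_term_summable) simp
  ultimately show ?thesis
    using sums_mult[OF sin_paired[of x], of 2] by (simp add: sums_iff)
qed

lemma fact_le_pochhammer_half: "fact n \<le> 2 * pochhammer (1/2 :: real) (Suc n)"
proof (induction n)
  case (Suc n)
  have "fact n * (real n + 1) \<le> 2 * pochhammer (1/2 :: real) (Suc n) * (1/2 + real (Suc n))"
    by (intro mult_mono Suc) (auto simp: pochhammer_half_pos less_imp_le)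
  then show ?case by (simp add: pochhammer_Suc[of _ "Suc n"] algebra_simps)
qed simp

lemma power_over_pochhammer_half: "(\<lambda>n. (c::real) ^ n / pochhammer (1/2) n) \<longlonglongrightarrow> 0"
\<comment> \<open>The shift to \<open>Suc n\<close> matches the comparison of \<open>fact n\<close>
  with \<open>pochhammer (1/2) (Suc n)\<close>.\<close>
proof (rule LIMSEQ_imp_Suc, rule tendsto_rabs_zero_cancel, rule tendsto_sandwich)
  show "\<forall>\<^sub>F n in sequentially. 0 \<le> \<bar>c ^ Suc n / pochhammer (1/2) (Suc n)\<bar>" by simp
  show "\<forall>\<^sub>F n in sequentially. \<bar>c ^ Suc n / pochhammer (1/2) (Suc n)\<bar> \<le> 2 * \<bar>c\<bar> * (\<bar>c\<bar> ^ n / fact n)"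
  proof (intro always_eventually allI)
    fix n
    have "\<bar>c\<bar> ^ Suc n / pochhammer (1/2) (Suc n) \<le> \<bar>c\<bar> ^ Suc n / (fact n / 2)"
      using fact_le_pochhammer_half[of n] pochhammer_half_pos[of "Suc n"]
      by (intro divide_left_mono) (auto simp del: power_Suc)
    then show "\<bar>c ^ Suc n / pochhammer (1/2) (Suc n)\<bar> \<le> 2 * \<bar>c\<bar> * (\<bar>c\<bar> ^ n / fact n)"
      using pochhammer_half_pos[of "Suc n"] by (simp add: abs_mult power_abs mult_ac)
  qed
  show "(\<lambda>n. 2 * \<bar>c\<bar> * (\<bar>c\<bar> ^ n / fact n)) \<longlonglongrightarrow> 0"
    by (intro tendsto_mult_right_zero summable_LIMSEQ_zero sums_summable[OF exp_sums_real])
qed simp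

theorem pi_squared_irrational: "pi\<^sup>2 \<notin> \<rat>"
proof
  assume "pi\<^sup>2 \<in> \<rat>"
  define y where "y = pi\<^sup>2 / 4"
  have y: "y \<in> \<rat>" "y > 0"
    unfolding y_def using \<open>pi\<^sup>2 \<in> \<rat>\<close> by auto
  obtain a b :: nat where ab: "b \<noteq> 0" "y = real a / real b"
    using Rats_abs_nat_div_natE[OF y(1)] y(2) by (metis abs_of_pos)
  \<comment> \<open>As \<open>c = 2 * b * y\<close>, one factor \<open>c\<close> clears both the
    denominator of \<open>y\<close> and the \<open>1/2\<close> in the recurrence, so that
    \<open>G\<close> satisfies a recurrence with integer coefficients.\<close>
  define c where "c = 2 * real a"
  define G where "G n = c ^ n * laczkovich y n" for n
  have G_rec: "G (n + 2) = real (b * (2 * n + 1)) * G (n + 1) - real (4 * a * b) * G n" for n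
  proof -
    have "c * laczkovich y (n + 2) = real b * (2 * real n + 1) * laczkovich y (n + 1) - 2 * real b * laczkovich y n"
      proof -
      have "c * laczkovich y (n + 2) = 2 * real b * (y * laczkovich y (n + 2))"
        using ab by (simp add: c_def)
      also have "\<dots> = real b * (2 * real n + 1) * laczkovich y (n + 1) - 2 * real b * laczkovich y n"
        unfolding laczkovich_rec[OF less_imp_le[OF y(2)]] by (simp add: algebra_simps)
      finally show ?thesis .
    qed
    then have "c ^ (n + 1) * (c * laczkovich y (n + 2)) =
        c ^ (n + 1) * (real b * (2 * real n + 1) * laczkovich y (n + 1) - 2 * real b * laczkovich y n)" by simp
    then show ?thesis by (simp add: G_def c_def algebra_simps)
  qed
  have "G n \<in> \<int> \<and> G (n + 1) \<in> \<int>" for n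
  proof (induction n)
    case 0
    have "laczkovich y 0 = -1" using laczkovich_0[of pi] by (simp add: y_def)
    moreover have "laczkovich y 1 = 0" using laczkovich_1[of pi] by (simp add: y_def)
    ultimately show ?case by (simp add: G_def)
  next
    case (Suc n)
    then show ?case using G_rec[of n] by (auto intro!: Ints_diff Ints_mult)
  qed
  then have G_int: "G n \<in> \<int>" for n by blast
  have "filterlim (\<lambda>n. real n + 1/2) at_top sequentially"
    by (rule filterlim_at_top_mono[OF filterlim_real_sequentially]) auto
  then have "(\<lambda>n. exp (y / (real n + 1/2)) - 1) \<longlonglongrightarrow> exp 0 - 1"
    by (intro tendsto_diff tendsto_exp tendsto_divide_0[OF tendsto_const] tendsto_const
        filterlim_at_top_imp_at_infinity)
  then have 1: "\<forall>\<^sub>F n in sequentially. exp (y / (real n + 1/2)) - 1 < 1"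
    by (rule order_tendstoD) simp
  have "(\<lambda>n. c ^ n / pochhammer (1/2) n) \<longlonglongrightarrow> 0" by (rule power_over_pochhammer_half)
  \<comment> \<open>The bound \<open>1/2\<close> compensates for the normalised value
    \<open>L\<close>, which is only known to lie below \<open>2\<close>.\<close>
  then have 2: "\<forall>\<^sub>F n in sequentially. c ^ n / pochhammer (1/2) n < 1/2"
    by (rule order_tendstoD) simp
  obtain n where n: "exp (y / (real n + 1/2)) - 1 < 1" "c ^ n / pochhammer (1/2) n < 1/2"
    using eventually_happens[OF eventually_conj[OF 1 2]] by auto
  define L where "L = laczkovich y n * pochhammer (1/2) n"
  have L: "0 < L" "L < 2" using laczkovich_bound[of y n] n(1) y by (auto simp: L_def)
  have "c > 0" using ab y by (cases "a = 0") (auto simp: c_def)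
  have GL: "G n = (c ^ n / pochhammer (1/2) n) * L"
    using pochhammer_half_pos[of n] by (simp add: G_def L_def)
  have q: "c ^ n / pochhammer (1/2) n > 0" using \<open>c > 0\<close> pochhammer_half_pos[of n] by simp
  have "G n > 0" unfolding GL by (rule mult_pos_pos[OF q L(1)])
  moreover have "c ^ n / pochhammer (1/2) n * L < 1/2 * 2"
    by (rule mult_strict_mono[OF n(2) L(2)]) (use L in auto)
  then have "G n < 1" unfolding GL by simp
  ultimately show False using G_int[of n] by (auto elim!: Ints_cases)
qed

subsection \<open>Summation of rational functions by partial fractions\<close>

text \<open>For \<open>p\<close> in \<open>S\<close>, this is the residue at \<open>t = - p\<close>
  of the quotient of the products of \<open>t + u\<close> over \<open>U\<close> and of
  \<open>t + s\<close> over \<open>S\<close>.\<close>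

definition pf_coeff :: "nat set \<Rightarrow> nat set \<Rightarrow> nat \<Rightarrow> real" where
  "pf_coeff U S p = (\<Prod>u\<in>U. real u - real p) / (\<Prod>q\<in>S - {p}. real q - real p)"

lemma pf_coeff_Rats: "pf_coeff U S p \<in> \<rat>"
  unfolding pf_coeff_def by (intro Rats_divide Rats_prod Rats_diff) auto

lemma degree_prod_linear_le:
  "finite A \<Longrightarrow> degree (\<Prod>a\<in>A. [:f a, 1 :: real:]) \<le> card A"
  using degree_prod_sum_le[of A "\<lambda>a. [:f a, 1 :: real:]"] by simp

text \<open>Lagrange interpolation: after clearing denominators, both sides are polynomials of
  degree below \<open>card S\<close> that agree at the \<open>card S\<close> points
  \<open>- p\<close>.\<close>

lemma partial_fractions:
  fixes t :: real
  assumes fin: "finite U" "finite S" and card: "card U < card S" and nz: "\<And>s. s \<in> S \<Longrightarrow> t + real s \<noteq> 0"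
  shows "(\<Prod>u\<in>U. t + real u) / (\<Prod>s\<in>S. t + real s) = (\<Sum>p\<in>S. pf_coeff U S p / (t + real p))"
proof -
  define lin where "lin a = [:real a, 1:]" for a
  have poly_lin: "poly (lin a) x = x + real a" for a x by (simp add: lin_def)
  define R where "R = (\<Sum>p\<in>S. smult (pf_coeff U S p) (\<Prod>q\<in>S - {p}. lin q))"
  have eq: "(\<Prod>u\<in>U. lin u) = R"
  proof (rule poly_eqI_degree)
    have "card ((\<lambda>p. - real p) ` S) = card S" by (rule card_image) (auto simp: inj_on_def)
    moreover have "degree (\<Prod>u\<in>U. lin u) \<le> card U"
      unfolding lin_def by (rule degree_prod_linear_le[OF fin(1)])
    moreover have "degree R \<le> card S - 1"
      unfolding R_def lin_def
    proof (rule degree_sum_le[OF fin(2)])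
      fix p assume "p \<in> S"
      then show "degree (smult (pf_coeff U S p) (\<Prod>q\<in>S - {p}. [:real q, 1:])) \<le> card S - 1"
        using degree_prod_linear_le[of "S - {p}" real] fin
        by (intro order_trans[OF degree_smult_le]) (simp add: card_Diff_singleton)
    qed
    ultimately show "degree (\<Prod>u\<in>U. lin u) < card ((\<lambda>p. - real p) ` S)"
      "degree R < card ((\<lambda>p. - real p) ` S)"
      using card by linarith+
  next
    fix x assume "x \<in> (\<lambda>p. - real p) ` S"
    then obtain p where p: "p \<in> S" "x = - real p" by blast
    have "poly R x = (\<Sum>p'\<in>S. pf_coeff U S p' * (\<Prod>q\<in>S - {p'}. real q - real p))"
      by (simp add: R_def poly_sum poly_prod poly_lin p(2))
    \<comment> \<open>For \<open>p'\<close> other than \<open>p\<close>, the product contains the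
      zero factor with \<open>q = p\<close>.\<close>
    also have "\<dots> = (\<Sum>p'\<in>{p}. pf_coeff U S p' * (\<Prod>q\<in>S - {p'}. real q - real p))"
      using p fin by (intro sum.mono_neutral_right) (auto simp: prod_zero_iff)
    also have "\<dots> = (\<Prod>u\<in>U. real u - real p)"
      using fin by (simp add: pf_coeff_def prod_zero_iff)
    finally show "poly (\<Prod>u\<in>U. lin u) x = poly R x"
      by (simp add: poly_prod poly_lin p(2))
  qed
  have "(\<Prod>u\<in>U. t + real u) = (\<Sum>p\<in>S. pf_coeff U S p * (\<Prod>q\<in>S - {p}. t + real q))"
    using arg_cong[OF eq, of "\<lambda>P. poly P t"] by (simp add: R_def poly_sum poly_prod poly_lin)
  also have "\<dots> / (\<Prod>s\<in>S. t + real s) = (\<Sum>p\<in>S. pf_coeff U S p / (t + real p))"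
    unfolding sum_divide_distrib
  proof (rule sum.cong[OF refl])
    fix p assume "p \<in> S"
    then have "(\<Prod>s\<in>S. t + real s) = (t + real p) * (\<Prod>q\<in>S - {p}. t + real q)"
      by (rule prod.remove[OF fin(2)])
    moreover have "(\<Prod>q\<in>S - {p}. t + real q) \<noteq> 0" using nz fin by (auto simp: prod_zero_iff)
    ultimately show "pf_coeff U S p * (\<Prod>q\<in>S - {p}. t + real q) / (\<Prod>s\<in>S. t + real s) = pf_coeff U S p / (t + real p)"
      by simp
  qed
  finally show ?thesis .
qed

section \<open>Series whose terms are products of two simple fractions\<close>

lemma sums_inverse_squares_shift:
  "\<exists>r\<in>\<rat>. (\<lambda>m. 1 / (real m + real (Suc p))\<^sup>2) sums (pi\<^sup>2 / 6 + r)"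
proof -
  let ?r = "\<Sum>m<p. 1 / (real m + 1)\<^sup>2"
  have "(\<lambda>m. 1 / (real (m + p) + 1)\<^sup>2) sums (pi\<^sup>2 / 6 - ?r)"
    using inverse_squares_sums by (subst sums_iff_shift) (simp add: add_ac)
  moreover have "?r \<in> \<rat>"
    by (intro Rats_sum Rats_divide Rats_power Rats_add) auto
  ultimately show ?thesis
    by (intro bexI[of _ "- ?r"]) (simp_all add: add_ac)
qed

text \<open>The series of \<open>1 / (m + p)\<close> diverges, so each is compared with the
  reference \<open>1 / (m + 1)\<close>; raising \<open>p\<close> by one adds a telescoping
  series.\<close>

lemma sums_inverse_diff:
  "\<exists>r\<in>\<rat>. (\<lambda>m. 1 / (real m + real (Suc p)) - 1 / (real m + 1)) sums r"
proof (induction p)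
  case 0
  show ?case using sums_zero by (intro bexI[of _ 0]) auto
next
  case (Suc p)
  then obtain r where r: "r \<in> \<rat>" "(\<lambda>m. 1 / (real m + real (Suc p)) - 1 / (real m + 1)) sums r" by blast
  have "(\<lambda>m. 1 / (real m + real (Suc p))) \<longlonglongrightarrow> 0"
    using LIMSEQ_inverse_real_of_nat[THEN LIMSEQ_ignore_initial_segment, of p] by (simp add: add_ac inverse_eq_divide)
  from telescope_sums[OF this]
  have "(\<lambda>m. 1 / (real m + real (Suc (Suc p))) - 1 / (real m + real (Suc p))) sums (- (1 / real (Suc p)))"
    by (simp add: add_ac)
  from sums_add[OF this r(2)] r(1) show ?case
    by (intro bexI[of _ "- (1 / real (Suc p)) + r"]) auto
qed

text \<open>Equal poles give a tail of the Basel series. For distinct poles the product is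
  \<open>1 / (q - p)\<close> times a difference of simple fractions, in which the reference series
  cancels.\<close>

lemma sums_inverse_prod:
  assumes "0 < p" "0 < q"
  shows "\<exists>r\<in>\<rat>. (\<lambda>m. 1 / ((real m + real p) * (real m + real q))) sums ((if p = q then pi\<^sup>2 / 6 else 0) + r)"
proof (cases "p = q")
  case True
  then show ?thesis
    using sums_inverse_squares_shift[of "p - 1"] assms by (simp add: power2_eq_square)
next
  case False
  obtain r where r: "r \<in> \<rat>" "(\<lambda>m. 1 / (real m + real p) - 1 / (real m + 1)) sums r"
    using sums_inverse_diff[of "p - 1"] assms by auto
  obtain s where s: "s \<in> \<rat>" "(\<lambda>m. 1 / (real m + real q) - 1 / (real m + 1)) sums s"
    using sums_inverse_diff[of "q - 1"] assms by auto
  have "(\<lambda>m. 1 / (real q - real p) *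
      ((1 / (real m + real p) - 1 / (real m + 1)) - (1 / (real m + real q) - 1 / (real m + 1))))
    sums (1 / (real q - real p) * (r - s))"
    by (intro sums_mult sums_diff r s)
  moreover have "1 / (real q - real p) *
      ((1 / (real m + real p) - 1 / (real m + 1)) - (1 / (real m + real q) - 1 / (real m + 1)))
      = 1 / ((real m + real p) * (real m + real q))" for m
  proof -
    have "real m + real p \<noteq> 0" "real m + real q \<noteq> 0" "real q - real p \<noteq> 0"
      using assms False by auto
    then show ?thesis by (simp add: divide_simps) (simp add: algebra_simps)
  qed
  ultimately show ?thesis
    using False r(1) s(1) by (intro bexI[of _ "1 / (real q - real p) * (r - s)"]) auto
qed

text \<open>Each of the two proper quotients is expanded separately, and the expansions are
  multiplied; only pairs of equal poles, hence those in \<open>S \<inter> T\<close>, yield a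
  multiple of \<open>pi\<^sup>2 / 6\<close>.\<close>

lemma sums_rational_function:
  assumes fin: "finite U" "finite V" "finite S" "finite T"
    and card: "card U < card S" "card V < card T" and pos: "0 \<notin> S" "0 \<notin> T"
  shows "\<exists>r\<in>\<rat>. (\<lambda>m. ((\<Prod>u\<in>U. real m + real u) * (\<Prod>v\<in>V. real m + real v)) /
      ((\<Prod>s\<in>S. real m + real s) * (\<Prod>t\<in>T. real m + real t)))
    sums ((\<Sum>p\<in>S \<inter> T. pf_coeff U S p * pf_coeff V T p) * (pi\<^sup>2 / 6) + r)"
proof -
  let ?c = "\<lambda>p q. pf_coeff U S p * pf_coeff V T q"
  let ?P = "\<lambda>p q r. r \<in> \<rat> \<and> (\<lambda>m. 1 / ((real m + real p) * (real m + real q)))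
      sums ((if p = q then pi\<^sup>2 / 6 else 0) + r)"
  \<comment> \<open>The rational remainders are chosen as a function of the pair, so that they can
    be summed over all pairs.\<close>
  define r where "r p q = (SOME r. ?P p q r)" for p q
  have r': "?P p q (r p q)" if "p \<in> S" "q \<in> T" for p q
  proof -
    have "0 < p" "0 < q" using that pos by (metis gr0I)+
    then have "\<exists>r. ?P p q r" using sums_inverse_prod[of p q] by (simp only: Bex_def)
    then show ?thesis unfolding r_def by (rule someI_ex)
  qed
  note r = r'[THEN conjunct1] r'[THEN conjunct2]
  let ?r = "\<Sum>p\<in>S. \<Sum>q\<in>T. ?c p q * r p q"
  have "(\<lambda>m. \<Sum>p\<in>S. \<Sum>q\<in>T. ?c p q * (1 / ((real m + real p) * (real m + real q))))
    sums (\<Sum>p\<in>S. \<Sum>q\<in>T. ?c p q * ((if p = q then pi\<^sup>2 / 6 else 0) + r p q))"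
    by (intro sums_sum sums_mult r)
  moreover have "(\<Sum>p\<in>S. \<Sum>q\<in>T. ?c p q * (1 / ((real m + real p) * (real m + real q)))) =
      ((\<Prod>u\<in>U. real m + real u) * (\<Prod>v\<in>V. real m + real v)) /
      ((\<Prod>s\<in>S. real m + real s) * (\<Prod>t\<in>T. real m + real t))" for m
  proof -
    have "real m + real s \<noteq> 0" if "s \<in> S \<union> T" for s
      using that pos by (cases s) auto
    then have "(\<Prod>u\<in>U. real m + real u) / (\<Prod>s\<in>S. real m + real s) *
        ((\<Prod>v\<in>V. real m + real v) / (\<Prod>t\<in>T. real m + real t)) =
        (\<Sum>p\<in>S. pf_coeff U S p / (real m + real p)) * (\<Sum>q\<in>T. pf_coeff V T q / (real m + real q))"
      using fin card by (intro arg_cong2[of _ _ _ _ "(*)"] partial_fractions) auto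
    then show ?thesis by (simp add: sum_product)
  qed
  moreover have "(\<Sum>p\<in>S. \<Sum>q\<in>T. ?c p q * ((if p = q then pi\<^sup>2 / 6 else 0) + r p q)) =
      (\<Sum>p\<in>S \<inter> T. ?c p p) * (pi\<^sup>2 / 6) + ?r"
  proof -
    have "(\<Sum>q\<in>T. ?c p q * (if p = q then pi\<^sup>2 / 6 else 0)) = (if p \<in> T then ?c p p * (pi\<^sup>2 / 6) else 0)" for p
      using fin by (simp add: if_distrib[of "\<lambda>x. _ * x"] sum.delta cong: if_cong)
    then show ?thesis
      using fin by (simp add: distrib_left sum.distrib sum_distrib_right flip: sum.inter_restrict)
  qed
  moreover have "?r \<in> \<rat>"
    by (intro Rats_sum Rats_mult pf_coeff_Rats r)
  ultimately show ?thesis by auto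
qed

section \<open>Signs of the partial fraction coefficients\<close>

lemma sgn_prod_diff:
  assumes "finite A" "p \<notin> A"
  shows "sgn (\<Prod>q\<in>A. real q - real p) = (- 1) ^ card {q \<in> A. q < p}"
proof -
  have "sgn (\<Prod>q\<in>A. real q - real p) = (\<Prod>q\<in>A. sgn (real q - real p))"
    using assms(1) by (induction A) (auto simp: sgn_mult)
  also have "\<dots> = (\<Prod>q\<in>A. if q < p then - 1 else 1)"
    using assms(2) by (intro prod.cong refl) (auto simp: sgn_if)
  also have "\<dots> = (- 1) ^ card {q \<in> A. q < p}"
    using assms(1) by (simp add: prod.If_cases Int_def)
  finally show ?thesis .
qed

lemma pf_coeff_sgn:
  assumes fin: "finite U" "finite S" and "p \<notin> U"
  shows "sgn (pf_coeff U S p) = (- 1) ^ (card {u \<in> U. u < p} + card {q \<in> S. q < p})"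
proof -
  have "{q \<in> S - {p}. q < p} = {q \<in> S. q < p}" by auto
  then show ?thesis
    unfolding pf_coeff_def sgn_divide
    using sgn_prod_diff[of U p] sgn_prod_diff[of "S - {p}" p] assms
    by (simp add: power_add minus_one_power_iff)
qed

lemma pf_coeff_eq_0: "finite U \<Longrightarrow> p \<in> U \<Longrightarrow> pf_coeff U S p = 0"
  by (auto simp: pf_coeff_def prod_zero_iff)

text \<open>For \<open>p \<le> n\<close>, one of the two numerators vanishes. All remaining terms
  are nonzero with a common sign, so they cannot cancel.\<close>

lemma double_pole_coeff_eq_0_iff:
  fixes h i j k n d :: nat
  defines "S \<equiv> {h + 1..h + i + 1}" and "T \<equiv> {k + 1..k + j + 1}"
  assumes "d \<le> n"
  shows "(\<Sum>p\<in>S \<inter> T. pf_coeff {1..d} S p * pf_coeff {d + 1..n} T p) = 0 \<longleftrightarrow> S \<inter> T \<subseteq> {1..n}"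
proof -
  let ?a = "\<lambda>p. pf_coeff {1..d} S p * pf_coeff {d + 1..n} T p" and ?e = "(- 1 :: real) ^ (n + h + k)"
  have zero: "?a p = 0" if "p \<in> S \<inter> T" "p \<le> n" for p
    using that by (cases "p \<le> d") (auto simp: pf_coeff_eq_0 S_def)
  have sgn: "sgn (?a p) = ?e" if p: "p \<in> S \<inter> T" "p > n" for p
  proof -
    \<comment> \<open>Since \<open>p > n\<close>, every numerator factor \<open>u - p\<close> is
      negative; in the denominators the negative factors are those of the poles below
      \<open>p\<close>.\<close>
    have "{u \<in> {1..d}. u < p} = {1..d}" "{u \<in> {d + 1..n}. u < p} = {d + 1..n}"
      "{q \<in> S. q < p} = {h + 1..<p}" "{q \<in> T. q < p} = {k + 1..<p}"
      using p \<open>d \<le> n\<close> by (auto simp: S_def T_def)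
    then have "sgn (pf_coeff {1..d} S p) = (- 1) ^ (d + (p - (h + 1)))"
      "sgn (pf_coeff {d + 1..n} T p) = (- 1) ^ ((n - d) + (p - (k + 1)))"
      using p \<open>d \<le> n\<close> by (simp_all add: pf_coeff_sgn S_def T_def)
    then have "sgn (?a p) = (- 1) ^ (d + (p - (h + 1)) + ((n - d) + (p - (k + 1))))"
      by (simp only: sgn_mult power_add)
    \<comment> \<open>The exponent equals \<open>n + 2 p - h - k - 2\<close>, so \<open>p\<close>
      does not affect its parity; the bounds on \<open>p\<close> make the truncated subtractions
      exact.\<close>
    moreover have "even (d + (p - (h + 1)) + ((n - d) + (p - (k + 1)))) \<longleftrightarrow> even (n + h + k)"
    proof -
      have "h + 1 \<le> p" "k + 1 \<le> p" using p by (auto simp: S_def T_def)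
      then show ?thesis using \<open>d \<le> n\<close> by presburger
    qed
    ultimately show ?thesis by (metis minus_one_power_iff)
  qed
  have "?e * ?e = 1" by (simp flip: power_mult_distrib)
  \<comment> \<open>Multiplying by the common sign reduces the claim to a vanishing sum of
    nonnegative terms.\<close>
  have nonneg: "?e * ?a p \<ge> 0" if "p \<in> S \<inter> T" for p
  proof (cases "p \<le> n")
    case False
    then have "sgn (?a p) = ?e" using sgn[OF that] by simp
    moreover have "sgn ?e = ?e" by (simp add: minus_one_power_iff)
    ultimately have "sgn (?e * ?a p) = 1" using \<open>?e * ?e = 1\<close> by (simp only: sgn_mult)
    then show ?thesis by (simp add: sgn_1_pos)
  next
    case True
    then have "?a p = 0" by (rule zero[OF that])
    then show ?thesis by (simp only: mult_zero_right order_refl)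
  qed
  have "(\<Sum>p\<in>S \<inter> T. ?a p) = 0 \<longleftrightarrow> (\<Sum>p\<in>S \<inter> T. ?e * ?a p) = 0"
    by (simp flip: sum_distrib_left)
  also have "\<dots> \<longleftrightarrow> (\<forall>p\<in>S \<inter> T. ?e * ?a p = 0)"
    using nonneg by (intro sum_nonneg_eq_0_iff) (auto simp: S_def)
  also have "\<dots> \<longleftrightarrow> (\<forall>p\<in>S \<inter> T. p \<le> n)"
  proof (intro ball_cong refl iffI)
    fix p assume p: "p \<in> S \<inter> T" and "?e * ?a p = 0"
    then have "sgn (?a p) = 0" by (auto simp: sgn_mult)
    with sgn[OF p] show "p \<le> n" by (cases "n < p") auto
  qed (use zero in simp)
  also have "\<dots> \<longleftrightarrow> S \<inter> T \<subseteq> {1..n}" by (auto simp: S_def)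
  finally show ?thesis .
qed

subsection \<open>Termwise integration\<close>

text \<open>The value of the Beta function at \<open>(a + 1, b + 1)\<close>.\<close>

definition beta_nat :: "nat \<Rightarrow> nat \<Rightarrow> real" where
  "beta_nat a b = fact a * fact b / fact (a + b + 1)"

lemma beta_nat_nonneg: "beta_nat a b \<ge> 0"
  by (simp add: beta_nat_def)

lemma fact_Rats: "(fact n :: real) \<in> \<rat>"
  by (metis Rats_of_nat of_nat_fact)

lemma beta_nat_Rats: "beta_nat a b \<in> \<rat>"
  unfolding beta_nat_def by (intro Rats_divide Rats_mult fact_Rats)

lemma has_integral_beta_nat: "((\<lambda>x. x ^ a * (1 - x) ^ b) has_integral beta_nat a b) {0..1}"
proof -
  have "Beta (real a + 1) (real b + 1) = beta_nat a b"
    using Gamma_fact[of a, where 'a = real] Gamma_fact[of b, where 'a = real]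
      Gamma_fact[of "a + b + 1", where 'a = real]
    by (simp add: Beta_def beta_nat_def add_ac)
  \<comment> \<open>On the open interval both bases are positive, so \<open>powr\<close> agrees with
    the natural power; at the endpoints it need not, as \<open>0 powr 0 = 0\<close>.\<close>
  then have "((\<lambda>x. x powr real a * (1 - x) powr real b) has_integral beta_nat a b) {0<..<1}"
    using has_integral_Beta_real[of "real a + 1" "real b + 1"] by (simp add: has_integral_Icc_iff_Ioo)
  then have "((\<lambda>x. x ^ a * (1 - x) ^ b) has_integral beta_nat a b) {0<..<1}"
    by (rule has_integral_eq[rotated]) (simp add: powr_realpow)
  then show ?thesis by (simp add: has_integral_Icc_iff_Ioo)
qed

lemma nn_integral_beta_nat:
  "(\<integral>\<^sup>+x. ennreal (x ^ a * (1 - x) ^ b) * indicator {0..1} x \<partial>lborel) = ennreal (beta_nat a b)"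
  by (rule nn_integral_has_integral_lebesgue'[OF _ has_integral_beta_nat]) auto

definition square_monomial :: "nat \<Rightarrow> nat \<Rightarrow> nat \<Rightarrow> nat \<Rightarrow> real \<times> real \<Rightarrow> real" where
  "square_monomial a b c d = (\<lambda>(x, y). x ^ a * (1 - x) ^ b * (y ^ c * (1 - y) ^ d))"

abbreviation unit_square :: "(real \<times> real) set" where
  "unit_square \<equiv> {0..1} \<times> {0..1}"

lemma square_monomial_nonneg: "z \<in> unit_square \<Longrightarrow> square_monomial a b c d z \<ge> 0"
  by (auto simp: square_monomial_def)

lemma square_monomial_measurable [measurable]: "square_monomial a b c d \<in> borel_measurable borel"
  unfolding square_monomial_def case_prod_beta
  by (intro borel_measurable_continuous_onI continuous_intros)

lemma unit_square_measurable [measurable]: "unit_square \<in> sets borel"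
  by (intro borel_closed closed_Times) auto

lemma nn_integral_square_monomial:
  "(\<integral>\<^sup>+z. ennreal (square_monomial a b c d z) * indicator unit_square z \<partial>lborel) =
     ennreal (beta_nat a b * beta_nat c d)"
proof -
  let ?f = "\<lambda>z. ennreal (square_monomial a b c d z) * indicator unit_square z"
  have "?f \<in> borel_measurable (lborel \<Otimes>\<^sub>M lborel)"
    unfolding lborel_prod by measurable
  then have "(\<integral>\<^sup>+z. ?f z \<partial>lborel) = (\<integral>\<^sup>+x. \<integral>\<^sup>+y. ?f (x, y) \<partial>lborel \<partial>lborel)"
    using lborel.nn_integral_fst[of ?f lborel] by (simp only: lborel_prod)
  also have "\<dots> = (\<integral>\<^sup>+x. \<integral>\<^sup>+y. ennreal (x ^ a * (1 - x) ^ b) * indicator {0..1} x *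
      (ennreal (y ^ c * (1 - y) ^ d) * indicator {0..1} y) \<partial>lborel \<partial>lborel)"
    by (intro nn_integral_cong)
      (auto simp: square_monomial_def indicator_def ennreal_mult)
  also have "\<dots> = ennreal (beta_nat a b) * ennreal (beta_nat c d)"
    by (simp add: nn_integral_cmult nn_integral_multc nn_integral_beta_nat)
  finally show ?thesis by (simp add: ennreal_mult beta_nat_nonneg)
qed

lemma has_bochner_integral_square_monomial:
  "has_bochner_integral lborel (\<lambda>z. indicator unit_square z * square_monomial a b c d z)
     (beta_nat a b * beta_nat c d)"
proof (rule has_bochner_integral_nn_integral)
  have "(\<integral>\<^sup>+z. ennreal (indicator unit_square z * square_monomial a b c d z) \<partial>lborel) =
      (\<integral>\<^sup>+z. ennreal (square_monomial a b c d z) * indicator unit_square z \<partial>lborel)"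
    by (intro nn_integral_cong) (auto simp: indicator_def)
  then show "(\<integral>\<^sup>+z. ennreal (indicator unit_square z * square_monomial a b c d z) \<partial>lborel) =
      ennreal (beta_nat a b * beta_nat c d)"
    by (simp only: nn_integral_square_monomial)
qed (auto simp: indicator_def square_monomial_nonneg beta_nat_nonneg)

lemma I_integral_alt:
  "I_integral h i j k l = (\<integral>z. indicator unit_square z *
     (square_monomial h i k j z / (1 - fst z * snd z) powi (int i + int j - int l + 1)) \<partial>lborel)"
  unfolding I_integral_def set_lebesgue_integral_def square_monomial_def
  by (intro Bochner_Integration.integral_cong refl) (auto simp: mult_ac)

text \<open>The denominator has exponent \<open>- e\<close> with \<open>e\<close> natural, so the
  integrand is a polynomial, and expanding \<open>(1 - x y)^e\<close> leaves a finite sum of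
  products of Beta values.\<close>

lemma I_integral_Rats_of_less:
  assumes "i + j < l"
  shows "I_integral h i j k l \<in> \<rat>"
proof -
  define e where "e = l - (i + j) - 1"
  have e: "int i + int j - int l + 1 = - int e" using assms by (simp add: e_def)
  have "indicator unit_square z * (square_monomial h i k j z / (1 - fst z * snd z) powi (- int e)) =
      (\<Sum>r\<le>e. real (e choose r) * (- 1) ^ r *
        (indicator unit_square z * square_monomial (h + r) i (k + r) j z))" for z
  proof (cases z)
    case (Pair x y)
    have "(1 - x * y) ^ e = (\<Sum>r\<le>e. real (e choose r) * (- 1) ^ r * (x ^ r * y ^ r))"
      using binomial_ring[of "- (x * y)" 1 e]
      by (simp add: power_minus[of "x * y"] power_mult_distrib mult_ac)
    moreover have "w / (1 - x * y) powi (- int e) = w * (1 - x * y) ^ e" for w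
      by (simp only: power_int_minus power_int_of_nat divide_inverse inverse_inverse_eq)
    ultimately show ?thesis
      by (simp add: Pair square_monomial_def sum_distrib_left power_add mult_ac)
  qed
  then have "I_integral h i j k l = (\<integral>z. (\<Sum>r\<le>e. real (e choose r) * (- 1) ^ r *
        (indicator unit_square z * square_monomial (h + r) i (k + r) j z)) \<partial>lborel)"
    by (simp only: I_integral_alt e)
  also have "\<dots> = (\<Sum>r\<le>e. real (e choose r) * (- 1) ^ r * (beta_nat (h + r) i * beta_nat (k + r) j))"
    by (intro has_bochner_integral_integral_eq has_bochner_integral_sum
        has_bochner_integral_mult_right has_bochner_integral_square_monomial)
  also have "\<dots> \<in> \<rat>"
    by (intro Rats_sum Rats_mult Rats_power beta_nat_Rats) auto
  finally show ?thesis .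
qed

text \<open>This is the general binomial series for the exponent \<open>- (n + 1)\<close> at
  \<open>- z\<close>; the sign of its coefficients cancels that of \<open>(- z) ^ m\<close>.\<close>

lemma neg_binomial_sums:
  fixes z :: real
  assumes "\<bar>z\<bar> < 1"
  shows "(\<lambda>m. real ((m + n) choose n) * z ^ m) sums (1 / (1 - z) ^ (n + 1))"
proof -
  have "(- (1 + real n) gchoose m) * (- z) ^ m = real ((m + n) choose n) * z ^ m" for m
  proof -
    have "real ((m + n) choose n) = (real (m + n) gchoose m)"
      by (metis add_diff_cancel_right' binomial_gbinomial binomial_symmetric le_add2)
    then have "(- (1 + real n) gchoose m) = (- 1) ^ m * real ((m + n) choose n)"
      using gbinomial_minus[of "1 + real n" m] by (simp add: algebra_simps)
    then have "(- (1 + real n) gchoose m) * (- z) ^ m = real ((m + n) choose n) * ((- 1) ^ m * (- z) ^ m)"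
      by (simp only: mult_ac)
    then show ?thesis by (simp flip: power_mult_distrib)
  qed
  moreover have "(1 + - z) powr (- (1 + real n)) = 1 / (1 - z) ^ (n + 1)"
    unfolding powr_minus_divide using assms powr_realpow[of "1 - z" "n + 1"] by (simp add: add_ac)
  ultimately show ?thesis
    using gen_binomial_real[of "- z" "- (1 + real n)"] assms by simp
qed

text \<open>All terms are nonnegative, so sum and integral may be exchanged in
  \<open>ennreal\<close>; the assumed convergence brings the result back to the reals.\<close>

lemma I_integral_sums:
  assumes "l \<le> i + j"
    and S: "(\<lambda>m. real ((m + (i + j - l)) choose (i + j - l)) * (beta_nat (h + m) i * beta_nat (k + m) j)) sums S"
  shows "I_integral h i j k l = S"
proof -
  define n where "n = i + j - l"
  define c where "c m = real ((m + n) choose n)" for m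
  have c: "c m \<ge> 0" for m by (simp add: c_def)
  have n: "int i + int j - int l + 1 = int (n + 1)" using assms by (simp add: n_def)
  define f where "f z = square_monomial h i k j z / (1 - fst z * snd z) ^ (n + 1)" for z
  have f_nonneg: "0 \<le> indicator unit_square z * f z" for z
    by (auto simp: f_def indicator_def square_monomial_nonneg mult_le_one
        intro!: divide_nonneg_nonneg zero_le_power)
  have f_meas: "(\<lambda>z. indicator unit_square z * f z) \<in> borel_measurable lborel"
  proof -
    have [measurable]: "(\<lambda>z :: real \<times> real. 1 - fst z * snd z) \<in> borel_measurable borel"
      by (intro borel_measurable_continuous_onI continuous_intros)
    show ?thesis unfolding f_def by measurable
  qed
  \<comment> \<open>The corner is excluded because the expansion needs \<open>x * y < 1\<close>. For
    \<open>i = j = 0\<close> the series diverges there, whereas division by zero makes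
    \<open>f\<close> equal to \<open>0\<close>; a single point is a null set.\<close>
  have f_sums: "ennreal (indicator unit_square z * f z) =
      (\<Sum>m. ennreal (c m) * (ennreal (square_monomial (h + m) i (k + m) j z) * indicator unit_square z))"
    if "z \<noteq> (1, 1)" for z
  proof (cases "z \<in> unit_square")
    case True
    obtain x y where z: "z = (x, y)" by (cases z)
    have xy: "0 \<le> x" "x \<le> 1" "0 \<le> y" "y \<le> 1" using True z by auto
    have "x * y < 1"
    proof (cases "x = 1")
      case True
      then show ?thesis using that xy z by auto
    next
      case False
      then show ?thesis using xy mult_left_mono[of y 1 x] by simp
    qed
    then have "(\<lambda>m. square_monomial h i k j z * (c m * (x * y) ^ m)) sums
        (square_monomial h i k j z * (1 / (1 - x * y) ^ (n + 1)))"
      unfolding c_def using xy by (intro sums_mult neg_binomial_sums) simp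
    then have "(\<lambda>m. c m * square_monomial (h + m) i (k + m) j z) sums f z"
      by (simp add: f_def z square_monomial_def power_add power_mult_distrib mult_ac)
    then have "(\<Sum>m. ennreal (c m * square_monomial (h + m) i (k + m) j z)) = ennreal (f z)"
      using True c square_monomial_nonneg by (intro suminf_ennreal_eq) auto
    then show ?thesis using True c by (simp add: ennreal_mult')
  qed simp
  have "I_integral h i j k l = (\<integral>z. indicator unit_square z * f z \<partial>lborel)"
    by (simp only: I_integral_alt n f_def power_int_of_nat)
  also have "\<dots> = enn2real (\<integral>\<^sup>+z. ennreal (indicator unit_square z * f z) \<partial>lborel)"
    using f_nonneg f_meas by (intro integral_eq_nn_integral) auto
  also have "(\<integral>\<^sup>+z. ennreal (indicator unit_square z * f z) \<partial>lborel) =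
      (\<integral>\<^sup>+z. (\<Sum>m. ennreal (c m) *
        (ennreal (square_monomial (h + m) i (k + m) j z) * indicator unit_square z)) \<partial>lborel)"
    by (intro nn_integral_cong_AE eventually_mono[OF AE_lborel_singleton[of "(1, 1)"]] f_sums)
  also have "\<dots> = (\<Sum>m. ennreal (c m) * ennreal (beta_nat (h + m) i * beta_nat (k + m) j))"
    by (subst nn_integral_suminf) (simp_all add: nn_integral_cmult nn_integral_square_monomial)
  also have "\<dots> = (\<Sum>m. ennreal (c m * (beta_nat (h + m) i * beta_nat (k + m) j)))"
    by (simp only: ennreal_mult' c)
  also have "\<dots> = ennreal S"
    using S by (intro suminf_ennreal_eq) (auto simp: c_def n_def beta_nat_nonneg)
  also have "enn2real \<dots> = S"
    using S by (intro enn2real_ennreal) (auto simp: sums_iff beta_nat_nonneg intro!: suminf_nonneg)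
  finally show ?thesis .
qed

section \<open>The terms of the series as a rational function of \<open>m\<close>\<close>

lemma prod_shift_fact:
  "(\<Prod>s\<in>{c + 1..c + d}. real m + real s) * fact (c + m) = fact (c + m + d)"
proof (induction d)
  case (Suc d)
  have "(\<Prod>s\<in>{c + 1..c + Suc d}. real m + real s) =
      (\<Prod>s\<in>{c + 1..c + d}. real m + real s) * (real m + real (c + Suc d))"
    by simp
  then have "(\<Prod>s\<in>{c + 1..c + Suc d}. real m + real s) * fact (c + m) =
      ((\<Prod>s\<in>{c + 1..c + d}. real m + real s) * fact (c + m)) * (real m + real (c + Suc d))"
    by (simp only: mult_ac)
  also have "\<dots> = fact (c + m + Suc d)"
    unfolding Suc by (simp add: algebra_simps)
  finally show ?case .
qed simp

lemma beta_nat_eq_prod: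
  "beta_nat (c + m) d = fact d / (\<Prod>s\<in>{c + 1..c + d + 1}. real m + real s)"
proof -
  have "beta_nat (c + m) d = fact (c + m) * fact d / fact (c + m + (d + 1))"
    by (simp add: beta_nat_def)
  also have "\<dots> = fact (c + m) * fact d / ((\<Prod>s\<in>{c + 1..c + (d + 1)}. real m + real s) * fact (c + m))"
    by (simp only: prod_shift_fact)
  finally show ?thesis by (simp add: add.assoc)
qed

lemma binomial_eq_prod: "real ((m + n) choose n) = (\<Prod>u\<in>{1..n}. real m + real u) / fact n"
proof -
  have "real ((m + n) choose n) = fact (m + n) / (fact n * fact m)"
    by (simp add: binomial_fact)
  also have "fact (m + n) = (\<Prod>u\<in>{1..n}. real m + real u) * fact m"
    using prod_shift_fact[where c = 0 and d = n and m = m] by simp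
  finally show ?thesis by simp
qed

subsection \<open>The integral as a rational combination of \<open>1\<close> and \<open>\<pi>\<^sup>2\<close>\<close>

lemma I_integral_eq:
  fixes h i j k l :: nat
  assumes "l \<le> i + j"
  defines "n \<equiv> i + j - l" and "S \<equiv> {h + 1..h + i + 1}" and "T \<equiv> {k + 1..k + j + 1}"
  shows "\<exists>A\<in>\<rat>. \<exists>r\<in>\<rat>. I_integral h i j k l = A * pi\<^sup>2 + r \<and> (A = 0 \<longleftrightarrow> S \<inter> T \<subseteq> {1..n})"
proof -
  \<comment> \<open>The numerator is cut at \<open>d\<close> so that both quotients are proper:
    \<open>d \<le> i < card S\<close>, and \<open>n - d \<le> j < card T\<close> because
    \<open>n \<le> i + j\<close>.\<close>
  define d where "d = min n i"
  have d: "d \<le> n" "d \<le> i" "n - d \<le> j" using assms(1) by (auto simp: d_def n_def)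
  define U where "U = {1..d}"
  define V where "V = {d + 1..n}"
  define a where "a = (\<Sum>p\<in>S \<inter> T. pf_coeff U S p * pf_coeff V T p)"
  \<comment> \<open>The factorials from the two Beta values and the binomial coefficient are
    constant in \<open>m\<close> and are collected here.\<close>
  define c where "c = (fact i * fact j / fact n :: real)"
  have a: "a \<in> \<rat>" unfolding a_def by (intro Rats_sum Rats_mult pf_coeff_Rats)
  have a_0: "a = 0 \<longleftrightarrow> S \<inter> T \<subseteq> {1..n}"
    unfolding a_def U_def V_def S_def T_def by (rule double_pole_coeff_eq_0_iff[OF d(1)])
  have c: "c \<in> \<rat>" "c \<noteq> 0" unfolding c_def by (intro Rats_divide Rats_mult fact_Rats) simp
  obtain r where r: "r \<in> \<rat>" "(\<lambda>m. ((\<Prod>u\<in>U. real m + real u) * (\<Prod>v\<in>V. real m + real v)) /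
      ((\<Prod>s\<in>S. real m + real s) * (\<Prod>t\<in>T. real m + real t))) sums (a * (pi\<^sup>2 / 6) + r)"
    using sums_rational_function[of U V S T] d unfolding a_def
    by (auto simp: U_def V_def S_def T_def)
  have "c * (((\<Prod>u\<in>U. real m + real u) * (\<Prod>v\<in>V. real m + real v)) /
      ((\<Prod>s\<in>S. real m + real s) * (\<Prod>t\<in>T. real m + real t))) =
      real ((m + n) choose n) * (beta_nat (h + m) i * beta_nat (k + m) j)" for m
  proof -
    have "{1..n} = U \<union> V" "U \<inter> V = {}" using d by (auto simp: U_def V_def)
    then have "(\<Prod>u\<in>{1..n}. real m + real u) = (\<Prod>u\<in>U. real m + real u) * (\<Prod>v\<in>V. real m + real v)"
      by (simp add: prod.union_disjoint U_def V_def)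
    then show ?thesis
      unfolding binomial_eq_prod beta_nat_eq_prod by (simp add: c_def S_def T_def)
  qed
  then have "I_integral h i j k l = c * (a * (pi\<^sup>2 / 6) + r)"
    using sums_mult[OF r(2), of c] assms(1) by (intro I_integral_sums) (simp_all add: n_def)
  also have "\<dots> = (c * a / 6) * pi\<^sup>2 + c * r" by (simp add: algebra_simps)
  finally show ?thesis
    using a c r(1) a_0 by (intro bexI[of _ "c * a / 6"] bexI[of _ "c * r"]) auto
qed

theorem theorem8:
  fixes h i j k l :: nat
  shows "(int j + int k - int h \<ge> 0 \<and> int k + int l - int i \<ge> 0 \<and> int l + int h - int j \<ge> 0
            \<and> int h + int i - int k \<ge> 0 \<and> int i + int j - int l \<ge> 0)
         \<longleftrightarrow> I_integral h i j k l \<notin> \<rat>"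
proof (cases "l \<le> i + j")
  case False
  then show ?thesis using I_integral_Rats_of_less[of i j l h k] by auto
next
  case True
  let ?S = "{h + 1..h + i + 1}" and ?T = "{k + 1..k + j + 1}" and ?n = "i + j - l"
  obtain A r where A: "A \<in> \<rat>" "r \<in> \<rat>" "I_integral h i j k l = A * pi\<^sup>2 + r"
    "A = 0 \<longleftrightarrow> ?S \<inter> ?T \<subseteq> {1..?n}"
    using I_integral_eq[OF True, of h k] by blast
  have "I_integral h i j k l \<in> \<rat> \<longleftrightarrow> A = 0"
  proof
    assume "I_integral h i j k l \<in> \<rat>"
    \<comment> \<open>If \<open>A\<close> were nonzero, this quotient would be
      \<open>pi\<^sup>2\<close>.\<close>
    then have "(I_integral h i j k l - r) / A \<in> \<rat>" using A by (intro Rats_divide Rats_diff)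
    then show "A = 0" using A(3) pi_squared_irrational by (auto split: if_splits)
  qed (use A in simp)
  \<comment> \<open>The intersection is the interval from \<open>max h k + 1\<close> to
    \<open>min (h + i) (k + j) + 1\<close>; it lies in \<open>{1..?n}\<close> iff it is empty or its
    last element is at most \<open>?n\<close>. The negation says \<open>h \<le> k + j\<close>,
    \<open>k \<le> h + i\<close>, \<open>j \<le> l + h\<close> and \<open>i \<le> k + l\<close>, the
    conditions remaining once \<open>l \<le> i + j\<close>.\<close>
  moreover have "?S \<inter> ?T \<subseteq> {1..?n} \<longleftrightarrow> min (h + i) (k + j) < max (max h k) ?n"
  proof
    assume sub: "?S \<inter> ?T \<subseteq> {1..?n}"
    show "min (h + i) (k + j) < max (max h k) ?n"
    proof (rule ccontr)
      assume "\<not> ?thesis"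
      then have "min (h + i) (k + j) + 1 \<in> ?S \<inter> ?T - {1..?n}" by auto
      then show False using sub by blast
    qed
  qed auto
  ultimately show ?thesis using A(4) True by auto
qed

end
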